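(* Let $((X_i)_{i\in N},(C_i)_{i\in N})$ be a game in choice form such that for each $x\in X$ there exists $i\in N$ with $C_i(x_{-i})\neq\emptyset$. Assume that, for each $i\in N$, the following conditions are fulfilled: (a) $X_i$ is a nonempty, convex and compact set in a Hausdorff topological vector space $E_i$; (b) there exists a nonempty subset $D_i$ of $C_i$ such that $W_i=\{x_{-i}\in X_{-i}: D_i(x_{-i})\neq\emptyset\}$ is closed, and $D_i(x_{-i})\neq\emptyset$ if and only if $C_i(x_{-i})\neq\emptyset$; (c) if $D_i(x_{-i})\neq\emptyset$, there exists an open neighborhood $V(x_{-i})$ of $x_{-i}$ in $X_{-i}$ such that $\bigcap_{z_{-i}\in V(x_{-i})}D_i(z_{-i})\neq\emptyset$; (d) $D_i(x_{-i})$ is convex or empty for each $x_{-i}\in X_{-i}$. Then the game admits an equilibrium in choice.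
   Context: $N=\{1,\dots,n\}$ is a finite set of players, $X=\prod_{i\in N}X_i$, $X_{-i}=\prod_{j\neq i}X_j$ (product topologies), $x_{-i}=(x_1,\dots,x_{i-1},x_{i+1},\dots,x_n)$, and $x=(x_{-i},x_i)$. A game in choice form is a double family $((X_i)_{i\in N},(C_i)_{i\in N})$, where the $X_i$ are nonempty sets (individual strategies) and $(C_i)_{i\in N}$ is a choice profile, i.e. a collection of nonempty subsets of $X$. For a subset $A\subseteq X$ (such as $C_i$ or $D_i$) attached to the index $i$, its upper section through $x_{-i}$ is $A(x_{-i})=\{y_i\in X_i:(x_{-i},y_i)\in A\}$; thus $C_i(x_{-i})=\{y_i\in X_i:(x_{-i},y_i)\in C_i\}$ and similarly for $D_i(x_{-i})$. An element $x^*\in X$ is an equilibrium in choice if $x_i^*\in C_i(x_{-i}^* )$ for every $i\in N$ for which $C_i(x_{-i}^* )\neq\emptyset$. *)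

theory Defs
  imports "HOL-Analysis.Analysis"
begin

text \<open>
  A real Hausdorff topological vector space is given by a topology whose underlying set is a
  linear subspace of an ambient real vector space that carries no topology of its own.
  A family of such topologies over one ambient type can thus model different spaces
  \<open>E\<^sub>i\<close>, each with its own vector topology: any family of topological vector spaces is
  isomorphic to a family of subspaces of the algebraic direct sum of its members.
\<close>

definition hausdorff_tvs :: "'v::real_vector topology \<Rightarrow> bool" where
  "hausdorff_tvs E \<longleftrightarrow>
     subspace (topspace E) \<and>
     Hausdorff_space E \<and>
     continuous_map (prod_topology E E) E (\<lambda>(x, y). x + y) \<and>
     continuous_map (prod_topology euclideanreal E) E (\<lambda>(c, x). c *\<^sub>R x)"

text \<open>
  The players are \<open>{1..n}\<close>. Profiles are extensional functions on the set of players, and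
  \<open>x\<^bsub>-i\<^esub>\<close> is an extensional function on \<open>{1..n} - {i}\<close>, so that \<open>(x\<^bsub>-i\<^esub>, y)\<close> is the
  function update \<open>x\<^bsub>-i\<^esub>(i := y)\<close>.
\<close>

definition profiles :: "nat \<Rightarrow> (nat \<Rightarrow> 'v set) \<Rightarrow> (nat \<Rightarrow> 'v) set" where
  "profiles n X = (\<Pi>\<^sub>E j\<in>{1..n}. X j)"

definition opp_profiles :: "nat \<Rightarrow> (nat \<Rightarrow> 'v set) \<Rightarrow> nat \<Rightarrow> (nat \<Rightarrow> 'v) set" where
  "opp_profiles n X i = (\<Pi>\<^sub>E j\<in>{1..n} - {i}. X j)"

definition opp :: "nat \<Rightarrow> nat \<Rightarrow> (nat \<Rightarrow> 'v) \<Rightarrow> (nat \<Rightarrow> 'v)" where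
  "opp n i x = restrict x ({1..n} - {i})"

definition opp_topology ::
    "nat \<Rightarrow> (nat \<Rightarrow> 'v topology) \<Rightarrow> (nat \<Rightarrow> 'v set) \<Rightarrow> nat \<Rightarrow> (nat \<Rightarrow> 'v) topology" where
  "opp_topology n E X i = product_topology (\<lambda>j. subtopology (E j) (X j)) ({1..n} - {i})"

definition upper_section ::
    "(nat \<Rightarrow> 'v set) \<Rightarrow> nat \<Rightarrow> (nat \<Rightarrow> 'v) set \<Rightarrow> (nat \<Rightarrow> 'v) \<Rightarrow> 'v set" where
  "upper_section X i A p = {y \<in> X i. p(i := y) \<in> A}"

definition game_in_choice_form ::
    "nat \<Rightarrow> (nat \<Rightarrow> 'v set) \<Rightarrow> (nat \<Rightarrow> (nat \<Rightarrow> 'v) set) \<Rightarrow> bool" where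
  "game_in_choice_form n X C \<longleftrightarrow>
     (\<forall>i\<in>{1..n}. X i \<noteq> {} \<and> C i \<noteq> {} \<and> C i \<subseteq> profiles n X)"

definition equilibrium_in_choice ::
    "nat \<Rightarrow> (nat \<Rightarrow> 'v set) \<Rightarrow> (nat \<Rightarrow> (nat \<Rightarrow> 'v) set) \<Rightarrow> (nat \<Rightarrow> 'v) \<Rightarrow> bool" where
  "equilibrium_in_choice n X C x \<longleftrightarrow>
     x \<in> profiles n X \<and>
     (\<forall>i\<in>{1..n}. upper_section X i (C i) (opp n i x) \<noteq> {} \<longrightarrow>
        x i \<in> upper_section X i (C i) (opp n i x))"

lemma topspace_opp_topology:
  assumes "\<And>j. j \<in> {1..n} \<Longrightarrow> X j \<subseteq> topspace (E j)"
  shows "topspace (opp_topology n E X i) = opp_profiles n X i"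
  unfolding opp_topology_def opp_profiles_def topspace_product_topology
  by (rule PiE_cong) (use assms in \<open>simp add: inf_absorb2\<close>)

lemma opp_update:
  assumes "x \<in> profiles n X" "i \<in> {1..n}"
  shows "opp n i x \<in> opp_profiles n X i" "(opp n i x)(i := x i) = x"
  using assms unfolding profiles_def opp_profiles_def opp_def
  by (auto simp: fun_eq_iff PiE_def Pi_def extensional_def)

end

theory Submission
  imports Defs
begin

text \<open>
  By (b) and (c) each \<open>W\<^sub>i\<close> is both closed and open; it is nonempty and \<open>X\<^bsub>-i\<^esub>\<close> is connected, so
  \<open>D\<^sub>i(x\<^bsub>-i\<^esub>)\<close> is nonempty for every \<open>x\<^bsub>-i\<^esub>\<close>. By compactness finitely many of the neighbourhoods in (c)
  cover \<open>X\<^bsub>-i\<^esub>\<close>, each with a point common to all values of \<open>D\<^sub>i\<close> on it. Convex combinations of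
  these points parametrise a finite-dimensional part of \<open>X\<close> by a product of simplices. The covers
  are pulled back to this parameter space, which is metrizable, so that partitions of unity need no
  normality of \<open>X\<^bsub>-i\<^esub>\<close>, and Brouwer's theorem yields parameters that are the values of the
  partitions of unity at the point they describe.
\<close>

section \<open>Brouwer's theorem on cubes of arbitrary finite dimension\<close>

text \<open>Coordinates from \<open>N\<close> on are pinned to 0, so cubes of all dimensions live in
  the one type \<open>nat \<Rightarrow> real\<close> with its product topology.\<close>

definition cube :: "nat \<Rightarrow> (nat \<Rightarrow> real) set" where
  "cube N = {x. \<forall>j. 0 \<le> x j \<and> x j \<le> 1 \<and> (N \<le> j \<longrightarrow> x j = 0)}"

text \<open>Tychonoff: the cube is a product over all of \<open>nat\<close>, with singleton factors
  from \<open>N\<close> on.\<close>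

lemma compact_cube: "compact (cube N)"
proof -
  have eq: "cube N = (\<Pi>\<^sub>E j\<in>UNIV. if j < N then {0..1} else {0})"
  proof (intro set_eqI iffI)
    fix x assume x: "x \<in> (\<Pi>\<^sub>E j\<in>UNIV. if j < N then {0..1} else {0 :: real})"
    have "0 \<le> x j \<and> x j \<le> 1 \<and> (N \<le> j \<longrightarrow> x j = 0)" for j
      using PiE_mem[OF x, of j] by (simp split: if_splits)
    then show "x \<in> cube N" by (simp add: cube_def)
  next
    fix x assume "x \<in> cube N"
    then show "x \<in> (\<Pi>\<^sub>E j\<in>UNIV. if j < N then {0..1} else {0 :: real})"
      by (auto simp: cube_def intro!: PiE_I)
  qed
  have "compactin (product_topology (\<lambda>_. euclideanreal) UNIV) (cube N)"
    unfolding eq compactin_PiE by auto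
  then show ?thesis
    by (simp add: euclidean_product_topology compactin_euclidean_iff)
qed

lemma tendsto_coordinatewise:
  fixes X :: "'c \<Rightarrow> 'a \<Rightarrow> 'b::topological_space"
  shows "(X \<longlongrightarrow> z) F \<longleftrightarrow> (\<forall>j. ((\<lambda>k. X k j) \<longlongrightarrow> z j) F)"
  using limitin_componentwise[of "\<lambda>_. euclidean" UNIV X z F]
  by (simp add: euclidean_product_topology)

text \<open>Kuhn's combinatorial lemma on the grid of mesh \<open>1 / real p\<close>. Label 0 at
  coordinate \<open>i\<close> certifies that \<open>f\<close> does not decrease it, label 1 that
  \<open>f\<close> does not increase it; the labels prescribed on opposite faces are consistent
  because \<open>f\<close> maps the cube into itself. The lemma yields a grid cell in which, for
  every \<open>i\<close>, two vertices carry different labels. These vertices are \<open>u\<close>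
  and \<open>v\<close>, and \<open>z\<close> is the lower corner of the cell.\<close>

lemma kuhn_approximate_fixpoint:
  assumes f: "\<And>x. x \<in> cube N \<Longrightarrow> f x \<in> cube N" and p: "0 < p"
  shows "\<exists>z\<in>cube N. \<forall>i<N. \<exists>u\<in>cube N. \<exists>v\<in>cube N. u i \<le> f u i \<and> f v i \<le> v i \<and>
           (\<forall>j. \<bar>u j - z j\<bar> \<le> 1 / real p \<and> \<bar>v j - z j\<bar> \<le> 1 / real p)"
proof -
  have "\<forall>x. x \<in> cube N \<longrightarrow> f x \<in> cube N" using f by blast
  moreover have "\<forall>x. x \<in> cube N \<longrightarrow> (\<forall>i. i < N \<longrightarrow> 0 \<le> x i \<and> x i \<le> 1)"
    by (simp add: cube_def)
  ultimately have "\<exists>l :: (nat \<Rightarrow> real) \<Rightarrow> nat \<Rightarrow> nat. (\<forall>x i. l x i \<le> 1) \<and>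
      (\<forall>x i. x \<in> cube N \<and> i < N \<and> x i = 0 \<longrightarrow> l x i = 0) \<and>
      (\<forall>x i. x \<in> cube N \<and> i < N \<and> x i = 1 \<longrightarrow> l x i = 1) \<and>
      (\<forall>x i. x \<in> cube N \<and> i < N \<and> l x i = 0 \<longrightarrow> x i \<le> f x i) \<and>
      (\<forall>x i. x \<in> cube N \<and> i < N \<and> l x i = 1 \<longrightarrow> f x i \<le> x i)"
    by (rule kuhn_labelling_lemma'[where P = "\<lambda>x. x \<in> cube N" and Q = "\<lambda>i. i < N"])
  then obtain l :: "(nat \<Rightarrow> real) \<Rightarrow> nat \<Rightarrow> nat" where L: "\<forall>x i. l x i \<le> 1"
    "\<forall>x i. x \<in> cube N \<and> i < N \<and> x i = 0 \<longrightarrow> l x i = 0"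
    "\<forall>x i. x \<in> cube N \<and> i < N \<and> x i = 1 \<longrightarrow> l x i = 1"
    "\<forall>x i. x \<in> cube N \<and> i < N \<and> l x i = 0 \<longrightarrow> x i \<le> f x i"
    "\<forall>x i. x \<in> cube N \<and> i < N \<and> l x i = 1 \<longrightarrow> f x i \<le> x i"
    by (elim exE conjE) (rule that)
  note l = L(1)[rule_format] L(2-5)[rule_format, OF conjI, OF _ conjI]
  define pt where "pt x = (\<lambda>j. if j < N then real (x j) / real p else 0)" for x :: "nat \<Rightarrow> nat"
  have pt: "pt x \<in> cube N" if "\<forall>j<N. x j \<le> p" for x
    using that p by (auto simp: cube_def pt_def)
  have k1: "\<forall>x. (\<forall>i<N. x i \<le> p) \<longrightarrow> (\<forall>i<N. l (pt x) i = 0 \<or> l (pt x) i = 1)"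
  proof (intro allI impI)
    show "l (pt x) i = 0 \<or> l (pt x) i = 1" for x i
      using l(1)[of "pt x" i] by linarith
  qed
  have k2: "\<forall>x. (\<forall>i<N. x i \<le> p) \<longrightarrow> (\<forall>i<N. x i = 0 \<longrightarrow> l (pt x) i = 0)"
    by (intro allI impI l(2) pt) (simp_all add: pt_def)
  have k3: "\<forall>x. (\<forall>i<N. x i \<le> p) \<longrightarrow> (\<forall>i<N. x i = p \<longrightarrow> l (pt x) i = 1)"
    using p by (intro allI impI l(3) pt) (simp_all add: pt_def)
  obtain q where q: "\<forall>i<N. q i < p"
    and rs: "\<forall>i<N. \<exists>r s. (\<forall>j<N. q j \<le> r j \<and> r j \<le> q j + 1) \<and>
               (\<forall>j<N. q j \<le> s j \<and> s j \<le> q j + 1) \<and> l (pt r) i \<noteq> l (pt s) i"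
    by (rule kuhn_lemma[where label = "\<lambda>x. l (pt x)", OF p k1 k2 k3]) (rule that)
  have near: "pt r \<in> cube N \<and> (\<forall>j. \<bar>pt r j - pt q j\<bar> \<le> 1 / real p)"
    if r: "\<forall>j<N. q j \<le> r j \<and> r j \<le> q j + 1" for r
  proof
    \<comment> \<open>Since \<open>q j < p\<close>, the upper corner \<open>q j + 1\<close> still
      lies on the grid.\<close>
    show "pt r \<in> cube N"
      using r q by (intro pt) fastforce
    show "\<forall>j. \<bar>pt r j - pt q j\<bar> \<le> 1 / real p"
    proof
      fix j
      have "\<bar>real (r j) - real (q j)\<bar> \<le> 1" if "j < N"
        using r that by force
      then show "\<bar>pt r j - pt q j\<bar> \<le> 1 / real p"
        using p by (auto simp: pt_def diff_divide_distrib[symmetric] divide_right_mono)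
    qed
  qed
  show ?thesis
  proof (rule bexI[of _ "pt q"], intro allI impI)
    show "pt q \<in> cube N"
      using q by (intro pt) auto
    fix i assume i: "i < N"
    obtain r s where r: "\<forall>j<N. q j \<le> r j \<and> r j \<le> q j + 1"
      and s: "\<forall>j<N. q j \<le> s j \<and> s j \<le> q j + 1" and ne: "l (pt r) i \<noteq> l (pt s) i"
      using rs i by blast
    \<comment> \<open>Either vertex may carry label 0; that one serves as \<open>u\<close> and the
      other as \<open>v\<close>.\<close>
    have "l (pt r) i = 0 \<and> l (pt s) i = 1 \<or> l (pt s) i = 0 \<and> l (pt r) i = 1"
      using ne l(1)[of "pt r" i] l(1)[of "pt s" i] by linarith
    then show "\<exists>u\<in>cube N. \<exists>v\<in>cube N. u i \<le> f u i \<and> f v i \<le> v i \<and>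
      (\<forall>j. \<bar>u j - pt q j\<bar> \<le> 1 / real p \<and> \<bar>v j - pt q j\<bar> \<le> 1 / real p)" (is ?uv)
    proof
      assume "l (pt r) i = 0 \<and> l (pt s) i = 1"
      then show ?uv
        using near[OF r] near[OF s] l(4)[of "pt r" i] l(5)[of "pt s" i] i
        by (intro bexI[of _ "pt r"] bexI[of _ "pt s"]) auto
    next
      assume "l (pt s) i = 0 \<and> l (pt r) i = 1"
      then show ?uv
        using near[OF r] near[OF s] l(4)[of "pt s" i] l(5)[of "pt r" i] i
        by (intro bexI[of _ "pt s"] bexI[of _ "pt r"]) auto
    qed
  qed
qed

text \<open>
  Stated for functions on \<open>nat\<close> because the dimension \<open>N\<close> depends on the sizes of finite covers and
  so cannot be a type, as the library's version of Brouwer's theorem would require.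
\<close>

lemma brouwer_cube_nat:
  assumes cont: "continuous_on (cube N) f" and f: "\<And>x. x \<in> cube N \<Longrightarrow> f x \<in> cube N"
  shows "\<exists>x\<in>cube N. f x = x"
proof -
  \<comment> \<open>Approximate fixed points for the meshes \<open>1 / real (Suc k)\<close>; the
    successor keeps the grid parameter positive at \<open>k = 0\<close>.\<close>
  have "\<exists>z. \<forall>k. z k \<in> cube N \<and> (\<forall>i<N. \<exists>u\<in>cube N. \<exists>v\<in>cube N. u i \<le> f u i \<and> f v i \<le> v i \<and>
           (\<forall>j. \<bar>u j - z k j\<bar> \<le> 1 / real (Suc k) \<and> \<bar>v j - z k j\<bar> \<le> 1 / real (Suc k)))"
  proof (rule choice, rule allI)
    fix k
    show "\<exists>z. z \<in> cube N \<and> (\<forall>i<N. \<exists>u\<in>cube N. \<exists>v\<in>cube N. u i \<le> f u i \<and> f v i \<le> v i \<and>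
           (\<forall>j. \<bar>u j - z j\<bar> \<le> 1 / real (Suc k) \<and> \<bar>v j - z j\<bar> \<le> 1 / real (Suc k)))"
      using kuhn_approximate_fixpoint[of N f "Suc k", OF f] unfolding Bex_def by simp
  qed
  then obtain z where z: "\<And>k. z k \<in> cube N"
    and uv: "\<And>i k. i < N \<Longrightarrow> \<exists>u\<in>cube N. \<exists>v\<in>cube N. u i \<le> f u i \<and> f v i \<le> v i \<and>
           (\<forall>j. \<bar>u j - z k j\<bar> \<le> 1 / real (Suc k) \<and> \<bar>v j - z k j\<bar> \<le> 1 / real (Suc k))"
    by blast
  \<comment> \<open>The countable product \<open>nat \<Rightarrow> real\<close> is first countable,
    so compactness gives a convergent subsequence. Its limit will be the fixed point.\<close>
  obtain a and \<sigma> :: "nat \<Rightarrow> nat" where a: "a \<in> cube N" "strict_mono \<sigma>" "(z \<circ> \<sigma>) \<longlonglongrightarrow> a"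
    using compact_imp_seq_compact[OF compact_cube] z unfolding seq_compact_def by metis
  \<comment> \<open>The vertices \<open>u\<close> and \<open>v\<close> vary with the coordinate
    \<open>i\<close>, but staying within the mesh forces them all to the same limit.\<close>
  have lim: "w \<longlonglongrightarrow> a" if w: "\<And>k j. \<bar>w k j - z (\<sigma> k) j\<bar> \<le> 1 / real (Suc (\<sigma> k))" for w
    unfolding tendsto_coordinatewise
  proof
    fix j
    have "(\<lambda>k. 1 / real (Suc (\<sigma> k))) \<longlonglongrightarrow> 0"
      using LIMSEQ_subseq_LIMSEQ[OF LIMSEQ_inverse_real_of_nat a(2)]
      by (simp add: o_def inverse_eq_divide)
    then have "(\<lambda>k. w k j - z (\<sigma> k) j) \<longlonglongrightarrow> 0"
      by (rule Lim_null_comparison[rotated]) (use w in simp)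
    moreover have "(\<lambda>k. z (\<sigma> k) j) \<longlonglongrightarrow> a j"
      using a(3) by (simp add: tendsto_coordinatewise)
    ultimately show "(\<lambda>k. w k j) \<longlonglongrightarrow> a j"
      using tendsto_add by fastforce
  qed
  have flim: "(\<lambda>k. f (w k) i) \<longlonglongrightarrow> f a i" if "w \<longlonglongrightarrow> a" "\<And>k. w k \<in> cube N" for w i
    using continuous_on_tendsto_compose[OF cont that(1) a(1)] that(2)
    by (simp add: tendsto_coordinatewise)
  have "f a i = a i" for i
  proof (cases "i < N")
    case True
    obtain u v where u: "\<And>k. u k \<in> cube N" "\<And>k. u k i \<le> f (u k) i"
      "\<And>k j. \<bar>u k j - z (\<sigma> k) j\<bar> \<le> 1 / real (Suc (\<sigma> k))"
      and v: "\<And>k. v k \<in> cube N" "\<And>k. f (v k) i \<le> v k i"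
      "\<And>k j. \<bar>v k j - z (\<sigma> k) j\<bar> \<le> 1 / real (Suc (\<sigma> k))"
    proof -
      have "\<forall>k. \<exists>u v. u \<in> cube N \<and> v \<in> cube N \<and> u i \<le> f u i \<and> f v i \<le> v i \<and>
          (\<forall>j. \<bar>u j - z (\<sigma> k) j\<bar> \<le> 1 / real (Suc (\<sigma> k)) \<and> \<bar>v j - z (\<sigma> k) j\<bar> \<le> 1 / real (Suc (\<sigma> k)))"
        using uv[OF True] unfolding Bex_def by blast
      then obtain u v where "\<And>k. u k \<in> cube N \<and> v k \<in> cube N \<and> u k i \<le> f (u k) i \<and> f (v k) i \<le> v k i \<and>
          (\<forall>j. \<bar>u k j - z (\<sigma> k) j\<bar> \<le> 1 / real (Suc (\<sigma> k)) \<and> \<bar>v k j - z (\<sigma> k) j\<bar> \<le> 1 / real (Suc (\<sigma> k)))"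
        unfolding choice_iff by blast
      then show thesis
        using that[of u v] by blast
    qed
    \<comment> \<open>The two one-sided inequalities at the vertices survive in the limit by
      continuity of \<open>f\<close>.\<close>
    have "a i \<le> f a i"
      using LIMSEQ_le[of "\<lambda>k. u k i" "a i" "\<lambda>k. f (u k) i" "f a i"] lim[OF u(3)] flim[OF _ u(1)] u(2)
      by (simp add: tendsto_coordinatewise)
    moreover have "f a i \<le> a i"
      using LIMSEQ_le[of "\<lambda>k. f (v k) i" "f a i" "\<lambda>k. v k i" "a i"] lim[OF v(3)] flim[OF _ v(1)] v(2)
      by (simp add: tendsto_coordinatewise)
    ultimately show ?thesis by simp
  next
    case False
    then show ?thesis using a(1) f[OF a(1)] by (simp add: cube_def)
  qed
  then show ?thesis using a(1) by blast
qed

section \<open>Vector operations and convex sets in topological vector spaces\<close>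

lemma hausdorff_tvs_zero: "hausdorff_tvs E \<Longrightarrow> 0 \<in> topspace E"
  by (simp add: hausdorff_tvs_def subspace_0)

lemma continuous_map_tvs_add:
  assumes "hausdorff_tvs E" "continuous_map T E f" "continuous_map T E g"
  shows "continuous_map T E (\<lambda>t. f t + g t)"
  using continuous_map_compose[OF continuous_map_pairedI[OF assms(2,3)], of E "\<lambda>(x, y). x + y"] assms(1)
  by (simp add: hausdorff_tvs_def o_def)

lemma continuous_map_tvs_scaleR:
  assumes "hausdorff_tvs E" "continuous_map T euclideanreal c" "y \<in> topspace E"
  shows "continuous_map T E (\<lambda>t. c t *\<^sub>R y)"
proof -
  have "continuous_map T E (\<lambda>t. y)" using assms(3) by simp
  from continuous_map_compose[OF continuous_map_pairedI[OF assms(2) this], of E "\<lambda>(x, y). x *\<^sub>R y"]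
  show ?thesis
    using assms(1) by (simp add: hausdorff_tvs_def o_def)
qed

text \<open>This makes the parametrisation of strategies by coefficients of fixed points
  continuous.\<close>

lemma continuous_map_tvs_sum:
  assumes "hausdorff_tvs E" "finite K"
    and "\<And>k. k \<in> K \<Longrightarrow> continuous_map T euclideanreal (c k)"
    and "\<And>k. k \<in> K \<Longrightarrow> y k \<in> topspace E"
  shows "continuous_map T E (\<lambda>t. \<Sum>k\<in>K. c k t *\<^sub>R y k)"
  using assms(2-4)
proof (induction K rule: finite_induct)
  case empty
  then show ?case using hausdorff_tvs_zero[OF assms(1)] by simp
next
  case (insert k K)
  then show ?case
    by (simp add: continuous_map_tvs_add continuous_map_tvs_scaleR assms(1))
qed

text \<open>Segments stay in \<open>S\<close> and are paths because the vector operations are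
  continuous. The connectedness of the spaces of opponents' profiles rests on this.\<close>

lemma convex_imp_path_connected_tvs:
  assumes E: "hausdorff_tvs E" and S: "convex S" "S \<subseteq> topspace E"
  shows "path_connected_space (subtopology E S)"
  unfolding path_connected_space_def
proof (intro ballI)
  fix x y assume "x \<in> topspace (subtopology E S)" "y \<in> topspace (subtopology E S)"
  then have xy: "x \<in> S" "y \<in> S" by auto
  define g where "g c = (1 - c) *\<^sub>R x + c *\<^sub>R y" for c :: real
  have "continuous_map (top_of_set {0..1}) E g"
    unfolding g_def using xy S(2)
    by (intro continuous_map_tvs_add continuous_map_tvs_scaleR E)
      (auto intro!: continuous_intros)
  moreover have "g c \<in> S" if "0 \<le> c" "c \<le> 1" for c
    using that xy S(1) by (simp add: g_def convex_def)
  ultimately have "pathin (subtopology E S) g"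
    by (auto simp: pathin_def continuous_map_in_subtopology)
  moreover have "g 0 = x" "g 1 = y"
    by (auto simp: g_def)
  ultimately show "\<exists>g. pathin (subtopology E S) g \<and> g 0 = x \<and> g 1 = y"
    by blast
qed

section \<open>Weight functions and simplex coordinates\<close>

text \<open>The weight is the distance to the complement of an open set that cuts out
  \<open>U\<close>; the metric does the work of Urysohn's lemma.\<close>

lemma openin_positivity_set:
  fixes S :: "'a::metric_space set"
  assumes "openin (top_of_set S) U"
  obtains w :: "'a \<Rightarrow> real" where "continuous_on S w" "\<And>t. 0 \<le> w t"
    "\<And>t. t \<in> S \<Longrightarrow> 0 < w t \<longleftrightarrow> t \<in> U"
proof -
  obtain G where G: "open G" "U = S \<inter> G"
    using assms by (auto simp: openin_open)
  show ?thesis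
  proof (cases "G = UNIV")
    \<comment> \<open>\<open>infdist\<close> to the empty set is 0 by convention, so an empty
      complement needs the constant weight 1.\<close>
    case True
    then show ?thesis using that[of "\<lambda>_. 1"] G(2) by auto
  next
    case False
    then have "0 < infdist t (- G) \<longleftrightarrow> t \<in> G" for t
      using G(1) in_closed_iff_infdist_zero[of "- G" t] infdist_nonneg[of t "- G"] by force
    then show ?thesis
      using G(2) by (intro that[of "\<lambda>t. infdist t (- G)"])
        (auto intro!: continuous_intros infdist_nonneg)
  qed
qed

text \<open>
  Maps nonnegative \<open>t\<close> onto the simplex over \<open>K\<close>: missing mass is spread evenly over \<open>K\<close>, and
  excess mass is scaled down.
\<close>

definition simplex_retraction :: "'a set \<Rightarrow> ('a \<Rightarrow> real) \<Rightarrow> 'a \<Rightarrow> real" where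
  "simplex_retraction K t j = (t j + max 0 (1 - sum t K) / real (card K)) / max 1 (sum t K)"

lemma simplex_retraction_nonneg: "0 \<le> t j \<Longrightarrow> 0 \<le> simplex_retraction K t j"
  by (simp add: simplex_retraction_def)

lemma sum_simplex_retraction:
  assumes "finite K" "K \<noteq> {}"
  shows "sum (simplex_retraction K t) K = 1"
proof -
  have "sum (simplex_retraction K t) K = (sum t K + max 0 (1 - sum t K)) / max 1 (sum t K)"
    using assms by (simp add: simplex_retraction_def sum.distrib flip: sum_divide_distrib)
  also have "\<dots> = 1" by (auto simp: max_def)
  finally show ?thesis .
qed

lemma simplex_retraction_id: "sum t K = 1 \<Longrightarrow> simplex_retraction K t j = t j"
  by (simp add: simplex_retraction_def)

lemma continuous_on_coordinate: "continuous_on S (\<lambda>t. t j :: 'b::topological_space)"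
  by (rule continuous_on_product_then_coordinatewise) (rule continuous_on_id)

lemma continuous_on_simplex_retraction: "continuous_on S (\<lambda>t. simplex_retraction K t j)"
  unfolding simplex_retraction_def
proof (cases "card K = 0")
  \<comment> \<open>Division by zero gives the constant 0 here, a case that the continuity rule for
    quotients excludes.\<close>
  case True
  then show "continuous_on S (\<lambda>t. (t j + max 0 (1 - sum t K) / real (card K)) / max 1 (sum t K))"
    by simp (intro continuous_intros continuous_on_coordinate, auto)
next
  case False
  then show "continuous_on S (\<lambda>t. (t j + max 0 (1 - sum t K) / real (card K)) / max 1 (sum t K))"
    by (intro continuous_intros continuous_on_coordinate) auto
qed

section \<open>A Fan-Browder type fixed point for finite covers\<close>

text \<open>The covers of all players are enumerated together by \<open>j < N\<close>, with
  \<open>own j\<close> the player, so that one fixed point settles all players at once. At the fixed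
  point the coefficient of \<open>y j\<close> is positive only if \<open>V j\<close> contains the
  opponents' profile, whence the convex hull.\<close>

lemma fan_browder_finite_cover:
  fixes X :: "nat \<Rightarrow> 'v::real_vector set" and own :: "nat \<Rightarrow> nat"
  assumes X: "\<And>i. i \<in> {1..n} \<Longrightarrow>
      hausdorff_tvs (E i) \<and> X i \<noteq> {} \<and> X i \<subseteq> topspace (E i) \<and> convex (X i)"
    and own: "\<And>j. j < N \<Longrightarrow> own j \<in> {1..n}"
    and y: "\<And>j. j < N \<Longrightarrow> y j \<in> X (own j)"
    and V: "\<And>j. j < N \<Longrightarrow> openin (opp_topology n E X (own j)) (V j)"
    and cover: "\<And>i p. i \<in> {1..n} \<Longrightarrow> p \<in> opp_profiles n X i \<Longrightarrow> \<exists>j<N. own j = i \<and> p \<in> V j"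
  obtains x where "x \<in> profiles n X"
    "\<And>i. i \<in> {1..n} \<Longrightarrow> x i \<in> convex hull {y j |j. j < N \<and> own j = i \<and> opp n i x \<in> V j}"
proof -
  define J where "J i = {j. j < N \<and> own j = i}" for i
  have finJ: "finite (J i)" for i
    by (simp add: J_def)
  have Jne: "J i \<noteq> {}" if "i \<in> {1..n}" for i
  proof -
    have "opp_profiles n X i \<noteq> {}"
      unfolding opp_profiles_def using X by (auto simp: PiE_eq_empty_iff)
    then show ?thesis using cover[OF that] by (auto simp: J_def)
  qed
  \<comment> \<open>The retraction turns arbitrary cube coordinates into convex coefficients for
    each player, so the domain can be the whole cube, where Brouwer's theorem is available.\<close>
  define \<Phi> where
    "\<Phi> t = (\<lambda>i\<in>{1..n}. \<Sum>j\<in>J i. simplex_retraction (J i) t j *\<^sub>R y j)" for t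
  let ?T = "top_of_set (cube N)"
  have \<Phi>_in: "\<Phi> t i \<in> X i" if "t \<in> cube N" "i \<in> {1..n}" for t i
  proof -
    have "(\<Sum>j\<in>J i. simplex_retraction (J i) t j *\<^sub>R y j) \<in> X i"
      using that X[OF that(2)] y finJ sum_simplex_retraction[OF finJ Jne[OF that(2)]]
      by (intro convex_sum simplex_retraction_nonneg) (auto simp: J_def cube_def)
    then show ?thesis using that by (simp add: \<Phi>_def)
  qed
  then have \<Phi>_prof: "\<Phi> t \<in> profiles n X" if "t \<in> cube N" for t
    using that by (auto simp: profiles_def \<Phi>_def)
  have \<Phi>_cont: "continuous_map ?T (subtopology (E i) (X i)) (\<lambda>t. \<Phi> t i)" if i: "i \<in> {1..n}" for i
  proof -
    have "continuous_map ?T (E i) (\<lambda>t. \<Sum>j\<in>J i. simplex_retraction (J i) t j *\<^sub>R y j)"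
      using X[OF i] y finJ
      by (intro continuous_map_tvs_sum)
        (auto simp: J_def continuous_on_simplex_retraction)
    then have "continuous_map ?T (E i) (\<lambda>t. \<Phi> t i)"
      using i by (simp add: \<Phi>_def)
    then show ?thesis
      using \<Phi>_in[OF _ i] by (auto simp: continuous_map_in_subtopology)
  qed
  have opp_cont: "continuous_map ?T (opp_topology n E X i) (\<lambda>t. opp n i (\<Phi> t))" for i
    unfolding opp_topology_def
  proof (rule continuous_map_coordinatewise_then_product)
    show "continuous_map ?T (subtopology (E k) (X k)) (\<lambda>t. opp n i (\<Phi> t) k)"
      if "k \<in> {1..n} - {i}" for k
      using \<Phi>_cont[of k] that by (simp add: opp_def)
  qed (auto simp: opp_def)
  \<comment> \<open>Pulling \<open>V j\<close> back along \<open>\<Phi>\<close> moves it into the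
    metric space of parameters.\<close>
  define U where "U j = {t \<in> cube N. opp n (own j) (\<Phi> t) \<in> V j}" for j
  have U: "openin ?T (U j)" if "j < N" for j
    using openin_continuous_map_preimage[OF opp_cont V[OF that]] by (simp add: U_def)
  have "\<exists>w :: (nat \<Rightarrow> real) \<Rightarrow> real. continuous_on (cube N) w \<and> (\<forall>t. 0 \<le> w t) \<and> (\<forall>t\<in>cube N. 0 < w t \<longleftrightarrow> t \<in> U j)"
    if "j < N" for j
    by (rule openin_positivity_set[OF U[OF that]]) blast
  then obtain w :: "nat \<Rightarrow> (nat \<Rightarrow> real) \<Rightarrow> real"
    where w: "\<And>j. j < N \<Longrightarrow> continuous_on (cube N) (w j)" "\<And>j t. j < N \<Longrightarrow> 0 \<le> w j t"
      "\<And>j t. j < N \<Longrightarrow> t \<in> cube N \<Longrightarrow> 0 < w j t \<longleftrightarrow> t \<in> U j"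
    by metis
  define W where "W i t = (\<Sum>j\<in>J i. w j t)" for i t
  \<comment> \<open>The sets \<open>V j\<close> owned by \<open>i\<close> cover, so normalising by
    \<open>W i\<close> never divides by zero.\<close>
  have W_pos: "0 < W i t" if i: "i \<in> {1..n}" and t: "t \<in> cube N" for i t
  proof -
    have "opp n i (\<Phi> t) \<in> opp_profiles n X i"
      using opp_update(1)[OF \<Phi>_prof[OF t] i] .
    then obtain j where "j < N" "own j = i" "opp n i (\<Phi> t) \<in> V j"
      using cover[OF i] by blast
    then have "j \<in> J i" "0 < w j t"
      using w(3)[of j t] t by (auto simp: J_def U_def)
    then show ?thesis
      unfolding W_def using finJ w(2) by (intro sum_pos2[of _ j]) (auto simp: J_def)
  qed
  \<comment> \<open>For each player the entries of \<open>g t\<close> form a partition of unity; the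
    value 0 from \<open>N\<close> on keeps \<open>g t\<close> in the cube.\<close>
  define g where "g t j = (if j < N then w j t / W (own j) t else 0)" for t j
  have "continuous_on (cube N) g"
  proof (rule continuous_on_coordinatewise_then_product)
    fix j
    show "continuous_on (cube N) (\<lambda>t. g t j)"
    proof (cases "j < N")
      case True
      have "continuous_on (cube N) (W (own j))"
        unfolding W_def[abs_def] using w(1) by (intro continuous_intros) (auto simp: J_def)
      then show ?thesis
        using True W_pos[OF own[OF True]] w(1)[OF True]
        by (auto simp: g_def intro!: continuous_intros) (metis less_irrefl)
    qed (simp add: g_def)
  qed
  moreover have "g t \<in> cube N" if t: "t \<in> cube N" for t
  proof -
    have "w j t \<le> W (own j) t" if "j < N" for j
      unfolding W_def using that w(2) finJ by (intro member_le_sum) (auto simp: J_def)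
    then show ?thesis
      using w(2) W_pos[OF own t] by (auto simp: cube_def g_def divide_le_eq_1 less_imp_le)
  qed
  ultimately obtain t where t: "t \<in> cube N" "g t = t"
    using brouwer_cube_nat by blast
  show thesis
  proof
    show "\<Phi> t \<in> profiles n X" using \<Phi>_prof t(1) .
    fix i assume i: "i \<in> {1..n}"
    let ?P = "{j \<in> J i. opp n i (\<Phi> t) \<in> V j}"
    have tj: "t j = w j t / W i t" if "j \<in> J i" for j
      using fun_cong[OF t(2), of j] that by (auto simp: g_def J_def)
    \<comment> \<open>The fixed point already lies in each player's simplex, so the retraction
      inside \<open>\<Phi>\<close> acts as the identity there.\<close>
    then have sum1: "sum t (J i) = 1"
      using W_pos[OF i t(1)] by (simp add: sum_divide_distrib[symmetric] W_def)
    have zero: "t j = 0" if "j \<in> J i - ?P" for j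
    proof -
      have "w j t = 0"
        using that w(2)[of j t] w(3)[of j t] t(1) by (auto simp: J_def U_def)
      then show ?thesis using that tj by simp
    qed
    have "\<Phi> t i = (\<Sum>j\<in>J i. t j *\<^sub>R y j)"
      using i by (simp add: \<Phi>_def simplex_retraction_id[OF sum1])
    also have "\<dots> = (\<Sum>j\<in>?P. t j *\<^sub>R y j)"
      using zero finJ by (intro sum.mono_neutral_right) auto
    also have "\<dots> \<in> convex hull {y j |j. j < N \<and> own j = i \<and> opp n i (\<Phi> t) \<in> V j}"
    proof (rule convex_sum)
      show "sum t ?P = 1"
        unfolding sum1[symmetric] using zero finJ by (intro sum.mono_neutral_left) auto
      show "0 \<le> t j" for j using t(1) by (simp add: cube_def)
      show "y j \<in> convex hull {y j |j. j < N \<and> own j = i \<and> opp n i (\<Phi> t) \<in> V j}" if "j \<in> ?P" for j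
        using that by (intro hull_inc) (auto simp: J_def)
    qed (auto simp: finJ)
    finally show "\<Phi> t i \<in> convex hull {y j |j. j < N \<and> own j = i \<and> opp n i (\<Phi> t) \<in> V j}" .
  qed
qed

section \<open>Set-valued maps with locally common values\<close>

text \<open>An element common to all values on \<open>V\<close> keeps these values nonempty, so the
  set of points with nonempty value is open as well as closed.\<close>

lemma locally_common_selection_nonempty:
  assumes conn: "connected_space T" and ne: "\<exists>p\<in>topspace T. F p \<noteq> {}"
    and closed: "closedin T {p \<in> topspace T. F p \<noteq> {}}"
    and local: "\<And>p. p \<in> topspace T \<Longrightarrow> F p \<noteq> {} \<Longrightarrow>
      \<exists>V. openin T V \<and> p \<in> V \<and> (\<Inter>z\<in>V. F z) \<noteq> {}"
    and p: "p \<in> topspace T"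
  shows "F p \<noteq> {}"
proof -
  define W where "W = {p \<in> topspace T. F p \<noteq> {}}"
  have "\<exists>V. openin T V \<and> q \<in> V \<and> V \<subseteq> W" if "q \<in> W" for q
  proof -
    obtain V where V: "openin T V" "q \<in> V" "(\<Inter>z\<in>V. F z) \<noteq> {}"
      using local[of q] \<open>q \<in> W\<close> unfolding W_def by auto
    then have "V \<subseteq> W"
      using openin_subset[OF V(1)] unfolding W_def by auto
    with V show ?thesis by auto
  qed
  then have "\<forall>q\<in>W. \<exists>V. openin T V \<and> q \<in> V \<and> V \<subseteq> W" by simp
  then have "openin T W"
    by (rule iffD2[OF openin_subopen])
  moreover have "closedin T W"
    using closed by (simp add: W_def)
  ultimately have "W = {} \<or> W = topspace T"
    using conn unfolding connected_space_clopen_in by simp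
  then show ?thesis using ne p unfolding W_def by auto
qed

text \<open>Each member is stored with its common point. Empty members are excluded because only
  some \<open>z \<in> V\<close> ties \<open>y\<close> to a value of \<open>F\<close>, and later to
  the strategy set.\<close>

lemma finite_subcover_with_selection:
  assumes T: "compact_space T"
    and local: "\<And>p. p \<in> topspace T \<Longrightarrow> \<exists>V. openin T V \<and> p \<in> V \<and> (\<Inter>z\<in>V. F z) \<noteq> {}"
  shows "\<exists>P. finite P \<and> (\<forall>(V, y)\<in>P. openin T V \<and> V \<noteq> {} \<and> (\<forall>z\<in>V. y \<in> F z)) \<and>
           (\<forall>p\<in>topspace T. \<exists>(V, y)\<in>P. p \<in> V)"
proof -
  define \<U> where "\<U> = {V. openin T V \<and> V \<noteq> {} \<and> (\<exists>y. \<forall>z\<in>V. y \<in> F z)}"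
  have "topspace T \<subseteq> \<Union>\<U>"
  proof
    fix p assume "p \<in> topspace T"
    then obtain V where "openin T V" "p \<in> V" "(\<Inter>z\<in>V. F z) \<noteq> {}"
      using local by meson
    then have "V \<in> \<U>" "p \<in> V" by (auto simp: \<U>_def)
    then show "p \<in> \<Union>\<U>" by (rule UnionI)
  qed
  then obtain \<F> where \<F>: "finite \<F>" "\<F> \<subseteq> \<U>" "topspace T \<subseteq> \<Union>\<F>"
    using compactinD[of T "topspace T" \<U>] T by (auto simp: compact_space_def \<U>_def)
  define y where "y V = (SOME y. \<forall>z\<in>V. y \<in> F z)" for V
  have y: "\<forall>z\<in>V. y V \<in> F z" if "V \<in> \<F>" for V
  proof -
    have "\<exists>y. \<forall>z\<in>V. y \<in> F z" using that \<F>(2) by (auto simp: \<U>_def)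
    then show ?thesis unfolding y_def by (rule someI_ex)
  qed
  show ?thesis
  proof (intro exI conjI)
    show "finite ((\<lambda>V. (V, y V)) ` \<F>)" using \<F>(1) by simp
    show "\<forall>(V, y)\<in>(\<lambda>V. (V, y V)) ` \<F>. openin T V \<and> V \<noteq> {} \<and> (\<forall>z\<in>V. y \<in> F z)"
      using \<F>(2) y by (simp add: subset_iff \<U>_def)
    show "\<forall>p\<in>topspace T. \<exists>(V, y)\<in>(\<lambda>V. (V, y V)) ` \<F>. p \<in> V"
      using \<F>(3) by (simp add: subset_iff)
  qed
qed

section \<open>Equilibria from finite covers\<close>

theorem theorem1:
  fixes n :: nat
    and E :: "nat \<Rightarrow> 'v::real_vector topology"
    and X :: "nat \<Rightarrow> 'v set"
    and C :: "nat \<Rightarrow> (nat \<Rightarrow> 'v) set"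
  assumes game: "game_in_choice_form n X C"
    and some_choice: "\<And>x. x \<in> profiles n X \<Longrightarrow>
          \<exists>i\<in>{1..n}. upper_section X i (C i) (opp n i x) \<noteq> {}"
    and a: "\<And>i. i \<in> {1..n} \<Longrightarrow>
          hausdorff_tvs (E i) \<and> X i \<noteq> {} \<and> X i \<subseteq> topspace (E i) \<and>
          convex (X i) \<and> compactin (E i) (X i)"
    and bcd: "\<And>i. i \<in> {1..n} \<Longrightarrow> \<exists>D.
          (D \<noteq> {} \<and> D \<subseteq> C i \<and>
           closedin (opp_topology n E X i)
             {p \<in> opp_profiles n X i. upper_section X i D p \<noteq> {}} \<and>
           (\<forall>p\<in>opp_profiles n X i.
              upper_section X i D p \<noteq> {} \<longleftrightarrow> upper_section X i (C i) p \<noteq> {})) \<and>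
          (\<forall>p\<in>opp_profiles n X i. upper_section X i D p \<noteq> {} \<longrightarrow>
             (\<exists>V. openin (opp_topology n E X i) V \<and> p \<in> V \<and>
                  (\<Inter>z\<in>V. upper_section X i D z) \<noteq> {})) \<and>
          (\<forall>p\<in>opp_profiles n X i.
             convex (upper_section X i D p) \<or> upper_section X i D p = {})"
  shows "\<exists>x. equilibrium_in_choice n X C x"
proof -
  obtain D where D: "\<And>i. i \<in> {1..n} \<Longrightarrow> D i \<noteq> {}" "\<And>i. i \<in> {1..n} \<Longrightarrow> D i \<subseteq> C i"
    and W: "\<And>i. i \<in> {1..n} \<Longrightarrow> closedin (opp_topology n E X i)
             {p \<in> opp_profiles n X i. upper_section X i (D i) p \<noteq> {}}"
    and nbhd: "\<And>i. i \<in> {1..n} \<Longrightarrow> \<forall>p\<in>opp_profiles n X i. upper_section X i (D i) p \<noteq> {} \<longrightarrow>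
             (\<exists>V. openin (opp_topology n E X i) V \<and> p \<in> V \<and>
                  (\<Inter>z\<in>V. upper_section X i (D i) z) \<noteq> {})"
    and conv': "\<And>i. i \<in> {1..n} \<Longrightarrow> \<forall>p\<in>opp_profiles n X i.
             convex (upper_section X i (D i) p) \<or> upper_section X i (D i) p = {}"
    by (rule exE[OF bchoice[OF ballI]], erule bcd)
      (rule that; drule (1) bspec; elim conjE; assumption)
  \<comment> \<open>The empty set is convex, so the alternative in (d) disappears.\<close>
  have conv: "convex (upper_section X i (D i) p)"
    if "i \<in> {1..n}" "p \<in> opp_profiles n X i" for i p
    using bspec[OF conv'[OF that(1)] that(2)] by (elim disjE) simp_all
  let ?T = "opp_topology n E X"
  have X: "hausdorff_tvs (E i)" "X i \<noteq> {}" "X i \<subseteq> topspace (E i)" "convex (X i)" "compactin (E i) (X i)"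
    if "i \<in> {1..n}" for i
    using a[OF that] by simp_all
  have top: "topspace (?T i) = opp_profiles n X i" for i
    by (rule topspace_opp_topology) (rule X(3))
  have connected: "connected_space (?T i)" for i
    unfolding opp_topology_def connected_space_product_topology
    by (intro disjI2 ballI path_connected_imp_connected_space convex_imp_path_connected_tvs X) simp_all
  have compact: "compact_space (?T i)" for i
    unfolding opp_topology_def compact_space_product_topology
    by (intro disjI2 ballI compact_space_subtopology X(5)) simp
  have section_nonempty: "upper_section X i (D i) p \<noteq> {}"
    if i: "i \<in> {1..n}" and p: "p \<in> opp_profiles n X i" for i p
  proof (rule locally_common_selection_nonempty[OF connected[of i]])
    \<comment> \<open>A profile in the nonempty set \<open>D i\<close> supplies the point with
      nonempty section from which connectedness spreads nonemptiness.\<close>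
    obtain x where x: "x \<in> D i" "x \<in> profiles n X"
      using D[OF i] bspec[OF game[unfolded game_in_choice_form_def] i] by blast
    moreover have "x i \<in> X i"
      using x(2) i by (auto simp: profiles_def)
    ultimately have "x i \<in> upper_section X i (D i) (opp n i x)"
      using opp_update(2)[OF x(2) i] by (simp add: upper_section_def)
    then show "\<exists>p\<in>topspace (?T i). upper_section X i (D i) p \<noteq> {}"
      using opp_update(1)[OF x(2) i] top by blast
  qed (use W[OF i] nbhd[OF i, rule_format] p top in auto)
  have exP: "\<exists>P. finite P \<and>
      (\<forall>(V, y)\<in>P. openin (?T i) V \<and> V \<noteq> {} \<and> (\<forall>z\<in>V. y \<in> upper_section X i (D i) z)) \<and>
      (\<forall>p\<in>topspace (?T i). \<exists>(V, y)\<in>P. p \<in> V)" if "i \<in> {1..n}" for i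
    by (rule finite_subcover_with_selection[OF compact])
      (rule nbhd[OF that, rule_format]; use section_nonempty[OF that] top in simp)
  obtain P where finP: "\<And>i. i \<in> {1..n} \<Longrightarrow> finite (P i)"
    and P: "\<And>i V y. i \<in> {1..n} \<Longrightarrow> (V, y) \<in> P i \<Longrightarrow>
      openin (?T i) V \<and> V \<noteq> {} \<and> (\<forall>z\<in>V. y \<in> upper_section X i (D i) z)"
    and cover: "\<And>i p. i \<in> {1..n} \<Longrightarrow> p \<in> opp_profiles n X i \<Longrightarrow> \<exists>(V, y)\<in>P i. p \<in> V"
    by (rule exE[OF bchoice[OF ballI]], erule exP) (rule that; drule (1) bspec; elim conjE; fastforce simp: top)
  \<comment> \<open>Tagging members with their player keeps the covers disjoint;
    \<open>card I\<close> becomes the dimension of the cube.\<close>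
  define I where "I = (SIGMA i:{1..n}. P i)"
  have "finite I"
    unfolding I_def by (rule finite_SigmaI[OF _ finP]) simp
  then obtain h where h: "bij_betw h {0..<card I} I"
    using ex_bij_betw_nat_finite by blast
  define own where "own j = fst (h j)" for j
  define V where "V j = fst (snd (h j))" for j
  define y where "y j = snd (snd (h j))" for j
  have "h j \<in> I" if "j < card I" for j
    using h that by (auto simp: bij_betw_def)
  then have own: "own j \<in> {1..n}" and VP: "(V j, y j) \<in> P (own j)" if "j < card I" for j
    using that by (fastforce simp: I_def own_def V_def y_def)+
  obtain x where x: "x \<in> profiles n X"
    and hull: "\<And>i. i \<in> {1..n} \<Longrightarrow>
      x i \<in> convex hull {y j |j. j < card I \<and> own j = i \<and> opp n i x \<in> V j}"
  proof (rule fan_browder_finite_cover[where n = n and E = E and X = X and N = "card I"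
        and own = own and y = y and V = V])
    show "y j \<in> X (own j)" if "j < card I" for j
      using P[OF own[OF that] VP[OF that]] by (auto simp: upper_section_def)
    show "\<exists>j<card I. own j = i \<and> p \<in> V j"
      if i: "i \<in> {1..n}" and p: "p \<in> opp_profiles n X i" for i p
    proof -
      obtain U z where "(U, z) \<in> P i" "p \<in> U"
        using cover[OF i p] by blast
      moreover from this i obtain j where "j < card I" "h j = (i, U, z)"
        using h unfolding bij_betw_def I_def by (metis (no_types, lifting) SigmaI atLeastLessThan_iff imageE)
      ultimately show ?thesis by (auto simp: own_def V_def)
    qed
  qed (use a own VP P in blast)+
  have "x i \<in> upper_section X i (C i) (opp n i x)" if i: "i \<in> {1..n}" for i
  proof -
    have opp: "opp n i x \<in> opp_profiles n X i"
      using opp_update(1)[OF x i] .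
    \<comment> \<open>\<open>y j\<close> lies in every section over \<open>V j\<close>, in
      particular over \<open>opp n i x\<close>; that section is convex and so contains the
      hull.\<close>
    have "{y j |j. j < card I \<and> own j = i \<and> opp n i x \<in> V j} \<subseteq> upper_section X i (D i) (opp n i x)"
      using P[OF own VP] by blast
    then have "convex hull {y j |j. j < card I \<and> own j = i \<and> opp n i x \<in> V j}
        \<subseteq> upper_section X i (D i) (opp n i x)"
      by (rule hull_minimal) (rule conv[OF i opp])
    then have "x i \<in> upper_section X i (D i) (opp n i x)"
      using hull[OF i] by (rule subsetD)
    then show ?thesis
      using D(2)[OF i] by (auto simp: upper_section_def)
  qed
  then show ?thesis
    using x unfolding equilibrium_in_choice_def by blast
qed

end
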